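(* Let $d\ge 2$ and let $\mathcal{B}=[b_{i_1,i_2,\ldots,i_d}]\in\mathbb{R}_+^{m_1\times\cdots\times m_d}$ be a given nonnegative tensor with no zero $(k,i_k)$ slice (for all $k\in\{1,\ldots,d\}$, $i_k\in\{1,\ldots,m_k\}$). Let $\mathbf{s}_k=(s_{k,1},\ldots,s_{k,m_k})^\top\in\mathbb{R}_+^{m_k}$, $k=1,\ldots,d$, be given positive vectors (all entries positive) satisfying $\sum_{i_1=1}^{m_1}s_{1,i_1}=\cdots=\sum_{i_d=1}^{m_d}s_{d,i_d}$. Consider, for vectors $\mathbf{x}_k=(x_{k,1},\ldots,x_{k,m_k})^\top\in\mathbb{R}^{m_k}$, $k=1,\ldots,d$, the system $$x_{1,i_1}+x_{2,i_2}+\cdots+x_{d,i_d}\le 0\ \text{ whenever } b_{i_1,i_2,\ldots,i_d}>0,\qquad \mathbf{s}_k^\top\mathbf{x}_k=0\ \text{ for } k=1,\ldots,d. \quad ( * )$$ For every $(\mathbf{x}_1,\ldots,\mathbf{x}_d)$ satisfying $( * )$ the following two conditions are equivalent: (1) $x_{1,i_1}+x_{2,i_2}+\cdots+x_{d,i_d}=0$ whenever $b_{i_1,i_2,\ldots,i_d}>0$; (2) $\sum_{(i_1,\ldots,i_d):\, b_{i_1,\ldots,i_d}>0}\left(x_{1,i_1}+x_{2,i_2}+\cdots+x_{d,i_d}\right)=0$. There exists a nonnegative tensor $\mathcal{A}\in\mathbb{R}_+^{m_1\times\cdots\times m_d}$ which is positive diagonally equivalent to $\mathcal{B}$ and has each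 $(k,i_k)$-slice sum equal to $s_{k,i_k}$ if and only if every $(\mathbf{x}_1,\ldots,\mathbf{x}_d)$ satisfying $( * )$ satisfies one of the equivalent conditions (1), (2). In particular, there exists at most one tensor $\mathcal{A}\in\mathbb{R}_+^{m_1\times\cdots\times m_d}$ with $(k,i_k)$-slice sum $s_{k,i_k}$ for all $k,i_k$ which is positive diagonally equivalent to $\mathcal{B}$.
   Context: $m_1,\ldots,m_d$ are positive integers. $\mathbb{R}^{m_1\times\cdots\times m_d}$ is the space of real $d$-mode tensors $[a_{i_1,\ldots,i_d}]$ with $i_j\in\{1,\ldots,m_j\}$, and $\mathbb{R}_+^{m_1\times\cdots\times m_d}$ is the cone of entrywise nonnegative ones. For $k\in\{1,\ldots,d\}$ and a fixed $i_k\in\{1,\ldots,m_k\}$, the $(k,i_k)$ slice of $\mathcal{A}=[a_{i_1,\ldots,i_d}]$ is the $(d-1)$-mode tensor obtained by fixing the $k$-th index to be $i_k$ and letting the other indices vary; the $(k,i_k)$-slice sum of $\mathcal{A}$ is the sum of all entries of this slice, $\sum_{i_j\in\{1,\ldots,m_j\},\,j\ne k}a_{i_1,\ldots,i_d}$. A zero slice is one all of whose entries are zero. Two tensors $\mathcal{A}=[a_{i_1,\ldots,i_d}]$ and $\mathcal{B}=[b_{i_1,\ldots,i_d}]$ in $\mathbb{R}^{m_1\times\cdots\times m_d}$ are positive diagonally equivalent if there exist $\mathbf{x}_k=(x_{k,1},\ldots,x_{k,m_k})^\top\in\mathbb{R}^{m_k}$, $k=1,\ldots,d$, such that $a_{i_1,\ldots,i_d}=b_{i_1,\ldots,i_d}\,e^{x_{1,i_1}+\cdots+x_{d,i_d}}$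 for all indices $i_1,\ldots,i_d$. *)

theory Defs
  imports Complex_Main "HOL-Library.FuncSet"
begin

text \<open>A multi-index is a function k \<mapsto> i_k on the modes 1..d with i_k in 1..m_k. It is
  extensional (undefined outside 1..d), so that distinct multi-indices are distinct functions
  and sums over all multi-indices are finite.\<close>

definition multi_indices :: "nat \<Rightarrow> (nat \<Rightarrow> nat) \<Rightarrow> (nat \<Rightarrow> nat) set" where
  "multi_indices d m = (\<Pi>\<^sub>E k\<in>{1..d}. {1..m k})"

text \<open>Tensors are extensional too, so that equality of tensors is equality of all entries.\<close>

definition nonneg_tensors :: "nat \<Rightarrow> (nat \<Rightarrow> nat) \<Rightarrow> ((nat \<Rightarrow> nat) \<Rightarrow> real) set" where
  "nonneg_tensors d m = multi_indices d m \<rightarrow>\<^sub>E {0..}"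

definition slice_indices :: "nat \<Rightarrow> (nat \<Rightarrow> nat) \<Rightarrow> nat \<Rightarrow> nat \<Rightarrow> (nat \<Rightarrow> nat) set" where
  "slice_indices d m k i = {I \<in> multi_indices d m. I k = i}"

definition zero_slice ::
    "nat \<Rightarrow> (nat \<Rightarrow> nat) \<Rightarrow> ((nat \<Rightarrow> nat) \<Rightarrow> real) \<Rightarrow> nat \<Rightarrow> nat \<Rightarrow> bool" where
  "zero_slice d m A k i \<longleftrightarrow> (\<forall>I\<in>slice_indices d m k i. A I = 0)"

definition slice_sum ::
    "nat \<Rightarrow> (nat \<Rightarrow> nat) \<Rightarrow> ((nat \<Rightarrow> nat) \<Rightarrow> real) \<Rightarrow> nat \<Rightarrow> nat \<Rightarrow> real" where
  "slice_sum d m A k i = (\<Sum>I\<in>slice_indices d m k i. A I)"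

text \<open>A family of vectors x_k in real m_k-space is a function x with entries x k i; only the
  values with k in 1..d and i in 1..m_k are ever used.\<close>

definition index_sum :: "nat \<Rightarrow> (nat \<Rightarrow> nat \<Rightarrow> real) \<Rightarrow> (nat \<Rightarrow> nat) \<Rightarrow> real" where
  "index_sum d x I = (\<Sum>k=1..d. x k (I k))"

definition pos_diag_equivalent ::
    "nat \<Rightarrow> (nat \<Rightarrow> nat) \<Rightarrow> ((nat \<Rightarrow> nat) \<Rightarrow> real) \<Rightarrow> ((nat \<Rightarrow> nat) \<Rightarrow> real) \<Rightarrow> bool" where
  "pos_diag_equivalent d m A B \<longleftrightarrow>
     (\<exists>x. \<forall>I\<in>multi_indices d m. A I = B I * exp (index_sum d x I))"

definition has_slice_sums ::
    "nat \<Rightarrow> (nat \<Rightarrow> nat) \<Rightarrow> ((nat \<Rightarrow> nat) \<Rightarrow> real) \<Rightarrow> (nat \<Rightarrow> nat \<Rightarrow> real) \<Rightarrow> bool" where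
  "has_slice_sums d m A s \<longleftrightarrow> (\<forall>k\<in>{1..d}. \<forall>i\<in>{1..m k}. slice_sum d m A k i = s k i)"

definition scaling_system ::
    "nat \<Rightarrow> (nat \<Rightarrow> nat) \<Rightarrow> ((nat \<Rightarrow> nat) \<Rightarrow> real) \<Rightarrow> (nat \<Rightarrow> nat \<Rightarrow> real)
      \<Rightarrow> (nat \<Rightarrow> nat \<Rightarrow> real) \<Rightarrow> bool" where
  "scaling_system d m B s x \<longleftrightarrow>
     (\<forall>I\<in>multi_indices d m. B I > 0 \<longrightarrow> index_sum d x I \<le> 0) \<and>
     (\<forall>k\<in>{1..d}. (\<Sum>i=1..m k. s k i * x k i) = 0)"

definition vanishes_on_support ::
    "nat \<Rightarrow> (nat \<Rightarrow> nat) \<Rightarrow> ((nat \<Rightarrow> nat) \<Rightarrow> real) \<Rightarrow> (nat \<Rightarrow> nat \<Rightarrow> real) \<Rightarrow> bool" where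
  "vanishes_on_support d m B x \<longleftrightarrow>
     (\<forall>I\<in>multi_indices d m. B I > 0 \<longrightarrow> index_sum d x I = 0)"

definition zero_total_on_support ::
    "nat \<Rightarrow> (nat \<Rightarrow> nat) \<Rightarrow> ((nat \<Rightarrow> nat) \<Rightarrow> real) \<Rightarrow> (nat \<Rightarrow> nat \<Rightarrow> real) \<Rightarrow> bool" where
  "zero_total_on_support d m B x \<longleftrightarrow>
     (\<Sum>I\<in>{I \<in> multi_indices d m. B I > 0}. index_sum d x I) = 0"

end

theory Submission
  imports Defs "HOL-Analysis.Function_Topology"
begin

text \<open>
  Everything rests on one identity: if \<open>A\<close> has slice sums \<open>s\<close>, then regrouping by slices gives
  \<open>\<Sum>\<^sub>I A I * index_sum d x I = \<Sum>\<^sub>k \<Sum>\<^sub>i s k i * x k i\<close> for every \<open>x\<close>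
  (\<open>sum_times_index_sum_eq_margins\<close>).

  For \<open>x\<close> solving the system the right-hand side is 0, while every term on the left is
  nonpositive; so each term vanishes, and \<open>A\<close> is positive on the support of \<open>B\<close>. This gives the
  necessity of the condition. For uniqueness, let \<open>A\<close> and \<open>A'\<close> be two scalings with the same slice
  sums, and write \<open>A I = A' I * exp (z\<^sub>I)\<close>, where \<open>z\<^sub>I\<close> is an index sum. The identity yields
  \<open>\<Sum>\<^sub>I A' I * (exp (z\<^sub>I) - 1) * z\<^sub>I = 0\<close>, a sum of nonnegative terms, whence \<open>A = A'\<close>.

  Sufficiency is a variational argument. Let \<open>\<sigma>\<close> be the common total of the vectors \<open>s k\<close>, and
  minimise over all \<open>y\<close>, without constraints, the convex function
  \<open>\<Sum>\<^sub>I B I * exp (index_sum d y I - (\<Sum>\<^sub>k \<Sum>\<^sub>i s k i * y k i) / \<sigma>)\<close>. The correction term in the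
  exponent amounts to replacing \<open>y\<close> by its translate whose components are orthogonal to the \<open>s k\<close>, so
  the hypothesis on the system says exactly that no direction makes all exponents on the support
  nonpositive and some of them negative. A finite sum of exponentials of linear forms without
  such a direction attains its minimum (\<open>exp_sum_attains_min\<close>). At a minimiser the partial
  derivatives vanish (\<open>exp_sum_stationary\<close>), and this says that the slice sums of the scaled
  tensor are proportional to \<open>s\<close>; a scalar factor, absorbed into the first mode, makes them equal.
\<close>

section \<open>Minimising sums of exponentials of linear forms\<close>

definition linear_form :: "'j set \<Rightarrow> ('j \<Rightarrow> real) \<Rightarrow> ('j \<Rightarrow> real) \<Rightarrow> real" where
  "linear_form J c y = (\<Sum>j\<in>J. c j * y j)"

definition exp_sum ::
    "'i set \<Rightarrow> 'j set \<Rightarrow> ('i \<Rightarrow> real) \<Rightarrow> ('i \<Rightarrow> 'j \<Rightarrow> real) \<Rightarrow> ('j \<Rightarrow> real) \<Rightarrow> real" where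
  "exp_sum S J b a y = (\<Sum>I\<in>S. b I * exp (linear_form J (a I) y))"

lemma linear_form_scale: "linear_form J c (\<lambda>j. t * y j) = t * linear_form J c y"
  by (simp add: linear_form_def sum_distrib_left ac_simps)

lemma linear_form_add_scale:
  "linear_form J c (\<lambda>j. x j + t * y j) = linear_form J c x + t * linear_form J c y"
  by (simp add: linear_form_def sum_distrib_left sum.distrib algebra_simps)

lemma continuous_on_linear_form [continuous_intros]: "continuous_on A (linear_form J c)"
  unfolding linear_form_def
  by (intro continuous_intros continuous_on_product_then_coordinatewise[OF continuous_on_id])

text \<open>The number of coordinates varies, so points are functions with the product topology; a
  coordinate outside \<open>J\<close> left free would destroy compactness, so it is set to 0.\<close>

lemma compact_coordinate_box:
  "compact {y :: 'j \<Rightarrow> real. \<forall>j. y j \<in> (if j \<in> J then {-R..R} else {0})}"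
proof -
  have "compactin (product_topology (\<lambda>_. euclidean) UNIV)
      (\<Pi>\<^sub>E j\<in>UNIV. if j \<in> J then {-R..R} else {0 :: real})"
    by (subst compactin_PiE) auto
  then show ?thesis
    by (simp add: PiE_UNIV_domain Pi_def euclidean_product_topology)
qed

text \<open>The function dominates \<open>p y = \<Sum>\<^sub>I b I * max 0 (L\<^sub>I y)\<close>, where \<open>L\<^sub>I\<close> are the linear forms. On
  the unit sphere of the maximum norm \<open>p\<close> is positive: at a zero of \<open>p\<close> all forms would be
  nonpositive, hence 0, and the point would be 0. By compactness \<open>p \<ge> c > 0\<close> there, and since
  \<open>p\<close> is positively homogeneous, the function grows at least linearly with slope \<open>c\<close>. Hence its
  minimum over a large enough box is global.\<close>

lemma exp_sum_attains_min_of_trivial_kernel: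
  fixes a :: "'i \<Rightarrow> 'j \<Rightarrow> real"
  assumes "finite S" and "finite J" and b: "\<And>I. I \<in> S \<Longrightarrow> b I > 0"
    and recession: "\<And>y. \<forall>I\<in>S. linear_form J (a I) y \<le> 0 \<Longrightarrow> \<forall>I\<in>S. linear_form J (a I) y = 0"
    and kernel: "\<And>y. \<forall>I\<in>S. linear_form J (a I) y = 0 \<Longrightarrow> \<forall>j\<in>J. y j = 0"
  shows "\<exists>y. \<forall>z. exp_sum S J b a y \<le> exp_sum S J b a z"
proof (cases "J = {}")
  case True
  then show ?thesis by (simp add: exp_sum_def linear_form_def)
next
  case False
  define box where "box R = {y :: 'j \<Rightarrow> real. \<forall>j. y j \<in> (if j \<in> J then {-R..R} else {0})}" for R
  define sphere where "sphere = box 1 \<inter> (\<Union>j\<in>J. {y. \<bar>y j\<bar> = 1})"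
  define p where "p y = (\<Sum>I\<in>S. b I * max 0 (linear_form J (a I) y))" for y
  have p_le: "p y \<le> exp_sum S J b a y" for y
    unfolding p_def exp_sum_def
  proof (intro sum_mono mult_left_mono)
    fix I
    show "max 0 (linear_form J (a I) y) \<le> exp (linear_form J (a I) y)"
      using exp_ge_add_one_self[of "linear_form J (a I) y"] exp_ge_zero[of "linear_form J (a I) y"] by linarith
  qed (use b less_imp_le in blast)
  have p_scale: "p (\<lambda>j. t * y j) = t * p y" if "t \<ge> 0" for t y
  proof -
    have "max 0 (t * z) = t * max 0 z" for z :: real
      using that by (simp add: max_mult_distrib_left)
    then show ?thesis
      by (simp add: p_def linear_form_scale sum_distrib_left mult.left_commute)
  qed
  have "compact sphere"
  proof -
    have "closed (\<Union>j\<in>J. {y :: 'j \<Rightarrow> real. \<bar>y j\<bar> = 1})"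
      using \<open>finite J\<close>
      by (intro closed_UN ballI closed_Collect_eq continuous_intros
          continuous_on_product_then_coordinatewise[OF continuous_on_id]) auto
    then show ?thesis
      unfolding sphere_def box_def by (intro compact_Int_closed compact_coordinate_box)
  qed
  moreover have "sphere \<noteq> {}"
  proof -
    have "(\<lambda>j. if j \<in> J then 1 else 0) \<in> sphere"
      using False by (auto simp: sphere_def box_def)
    then show ?thesis by blast
  qed
  moreover have "continuous_on sphere p"
    unfolding p_def by (intro continuous_intros)
  ultimately obtain u0 where u0: "u0 \<in> sphere" "\<And>u. u \<in> sphere \<Longrightarrow> p u0 \<le> p u"
    using continuous_attains_inf by metis
  define c where "c = p u0"
  have "c > 0"
  proof -
    have "\<not> (\<forall>I\<in>S. linear_form J (a I) u0 \<le> 0)"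
      using recession[of u0] kernel[of u0] u0(1) by (fastforce simp: sphere_def)
    then obtain I where "I \<in> S" "linear_form J (a I) u0 > 0"
      by (meson not_le)
    then show ?thesis
      unfolding c_def p_def using \<open>finite S\<close> b
      by (intro sum_pos2[of S I]) (auto simp: less_imp_le)
  qed
  \<comment> \<open>Beyond radius \<open>R\<close> the lower bound \<open>p\<close> exceeds the value at the origin.\<close>
  define R where "R = exp_sum S J b a (\<lambda>_. 0) / c"
  have "R \<ge> 0"
    unfolding R_def exp_sum_def using b \<open>c > 0\<close>
    by (intro divide_nonneg_pos sum_nonneg mult_nonneg_nonneg) (auto simp: less_imp_le)
  have "continuous_on (box R) (exp_sum S J b a)"
    unfolding exp_sum_def by (intro continuous_intros)
  moreover have zero_in: "(\<lambda>_. 0) \<in> box R"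
    using \<open>R \<ge> 0\<close> by (auto simp: box_def)
  ultimately obtain y where y: "\<And>z. z \<in> box R \<Longrightarrow> exp_sum S J b a y \<le> exp_sum S J b a z"
    using continuous_attains_inf[of "box R" "exp_sum S J b a"] compact_coordinate_box[of J R]
    unfolding box_def by blast
  have "exp_sum S J b a y \<le> exp_sum S J b a z" for z
  proof -
    \<comment> \<open>Only the coordinates in \<open>J\<close> matter, but points of the box are 0 elsewhere.\<close>
    define z' where "z' j = (if j \<in> J then z j else 0)" for j
    have z': "exp_sum S J b a z' = exp_sum S J b a z"
      unfolding exp_sum_def z'_def by (simp add: linear_form_def)
    define t where "t = Max ((\<lambda>j. \<bar>z j\<bar>) ` J)"
    have t_ge: "\<bar>z j\<bar> \<le> t" if "j \<in> J" for j
      unfolding t_def using that \<open>finite J\<close> by simp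
    obtain j0 where j0: "j0 \<in> J" "\<bar>z j0\<bar> = t"
    proof -
      have "t \<in> (\<lambda>j. \<bar>z j\<bar>) ` J"
        unfolding t_def using False \<open>finite J\<close> by (intro Max_in) auto
      then show ?thesis using that by auto
    qed
    show ?thesis
    proof (cases "t \<le> R")
      case True
      then have "z' \<in> box R"
        using t_ge by (fastforce simp: box_def z'_def abs_le_iff)
      then show ?thesis using y z' by metis
    next
      case False
      then have "t > 0" using \<open>R \<ge> 0\<close> by linarith
      define u where "u j = z' j / t" for j
      have "u \<in> sphere"
      proof -
        have "- 1 \<le> z j / t \<and> z j / t \<le> 1" if "j \<in> J" for j
          using t_ge[OF that] \<open>t > 0\<close> by (simp add: abs_le_iff field_simps)
        then have "u \<in> box 1"
          by (simp add: box_def u_def z'_def)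
        moreover have "\<bar>u j0\<bar> = 1"
          using j0 \<open>t > 0\<close> by (simp add: u_def z'_def)
        ultimately show ?thesis
          using j0(1) by (auto simp: sphere_def)
      qed
      have "exp_sum S J b a y \<le> exp_sum S J b a (\<lambda>_. 0)"
        using y zero_in by blast
      also have "\<dots> = R * c"
        using \<open>c > 0\<close> by (simp add: R_def)
      also have "\<dots> \<le> t * p u"
        using False \<open>c > 0\<close> \<open>t > 0\<close> u0(2)[OF \<open>u \<in> sphere\<close>] unfolding c_def
        by (intro mult_mono) auto
      also have "\<dots> = p z'"
        using p_scale[of t u] \<open>t > 0\<close> by (simp add: u_def)
      also have "\<dots> \<le> exp_sum S J b a z"
        using p_le[of z'] z' by simp
      finally show ?thesis .
    qed
  qed
  then show ?thesis by blast
qed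

text \<open>A common zero \<open>v\<close> of the linear forms with \<open>v j\<^sub>0 \<noteq> 0\<close> makes the coordinate \<open>j\<^sub>0\<close> redundant,
  since every point can be moved along \<open>v\<close> to one with \<open>j\<^sub>0\<close>-coordinate 0 without changing any form.
  Removing such coordinates one by one leads to the case of a trivial common kernel.\<close>

lemma exp_sum_attains_min:
  fixes a :: "'i \<Rightarrow> 'j \<Rightarrow> real"
  assumes "finite S" and "finite J" and b: "\<And>I. I \<in> S \<Longrightarrow> b I > 0"
    and recession: "\<And>y. \<forall>I\<in>S. linear_form J (a I) y \<le> 0 \<Longrightarrow> \<forall>I\<in>S. linear_form J (a I) y = 0"
  shows "\<exists>y. \<forall>z. exp_sum S J b a y \<le> exp_sum S J b a z"
  using \<open>finite J\<close> recession
proof (induction J rule: finite_psubset_induct)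
  case (psubset J)
  show ?case
  proof (cases "\<forall>y. (\<forall>I\<in>S. linear_form J (a I) y = 0) \<longrightarrow> (\<forall>j\<in>J. y j = 0)")
    case True
    then show ?thesis
      using exp_sum_attains_min_of_trivial_kernel[where b = b, OF \<open>finite S\<close> psubset.hyps(1) b psubset.prems]
      by blast
  next
    case False
    then obtain v j0 where v: "\<And>I. I \<in> S \<Longrightarrow> linear_form J (a I) v = 0" and j0: "j0 \<in> J" "v j0 \<noteq> 0"
      by blast
    let ?J = "J - {j0}"
    have restrict: "linear_form ?J c y = linear_form J c (y(j0 := 0))" for c y
      using j0 psubset.hyps(1) by (simp add: linear_form_def sum.remove)
    have "\<forall>I\<in>S. linear_form ?J (a I) y = 0" if "\<forall>I\<in>S. linear_form ?J (a I) y \<le> 0" for y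
      using that psubset.prems[of "y(j0 := 0)"] unfolding restrict by blast
    moreover have "?J \<subset> J" using j0 by blast
    ultimately obtain y where y: "\<And>z. exp_sum S ?J b a y \<le> exp_sum S ?J b a z"
      using psubset.IH[of ?J] by blast
    have "exp_sum S J b a (y(j0 := 0)) \<le> exp_sum S J b a z" for z
    proof -
      define w where "w j = z j + (- z j0 / v j0) * v j" for j
      have "w j0 = 0" using j0 by (simp add: w_def)
      then have w: "w(j0 := 0) = w" by auto
      have "linear_form J (a I) w = linear_form J (a I) z" if "I \<in> S" for I
        unfolding w_def linear_form_add_scale using v[OF that] by simp
      then have "exp_sum S J b a z = exp_sum S ?J b a w"
        by (simp add: exp_sum_def restrict w)
      moreover have "exp_sum S ?J b a y = exp_sum S J b a (y(j0 := 0))"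
        by (simp add: exp_sum_def restrict)
      ultimately show ?thesis using y[of w] by simp
    qed
    then show ?thesis by blast
  qed
qed

lemma exp_sum_stationary:
  fixes a :: "'i \<Rightarrow> 'j \<Rightarrow> real"
  assumes "finite J" and "j \<in> J" and min: "\<And>z. exp_sum S J b a y \<le> exp_sum S J b a z"
  shows "(\<Sum>I\<in>S. b I * exp (linear_form J (a I) y) * a I j) = 0"
proof -
  define e where "e i = (if i = j then 1 else 0 :: real)" for i
  define g where "g t = exp_sum S J b a (\<lambda>i. y i + t * e i)" for t
  have e: "linear_form J c e = c j" for c
    using assms(1,2) by (simp add: linear_form_def e_def if_distrib cong: if_cong)
  have "(g has_real_derivative (\<Sum>I\<in>S. b I * (exp (linear_form J (a I) y + 0 * a I j) * a I j))) (at 0)"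
    unfolding g_def exp_sum_def linear_form_add_scale e
    by (auto intro!: derivative_eq_intros sum.cong)
  moreover have "g 0 \<le> g t" for t
    unfolding g_def using min by simp
  ultimately have "(\<Sum>I\<in>S. b I * (exp (linear_form J (a I) y + 0 * a I j) * a I j)) = 0"
    by (intro DERIV_local_min[of g _ 0 1]) auto
  then show ?thesis by (simp add: mult.assoc)
qed

section \<open>Slice sums as a pairing\<close>

lemma finite_multi_indices: "finite (multi_indices d m)"
  by (simp add: multi_indices_def finite_PiE)

lemma multi_indices_in: "I \<in> multi_indices d m \<Longrightarrow> k \<in> {1..d} \<Longrightarrow> I k \<in> {1..m k}"
  unfolding multi_indices_def by blast

text \<open>The map from \<open>x\<close> to its index sums is the transpose of the map from a tensor to its slice
  sums: for each mode \<open>k\<close>, group the multi-indices by their \<open>k\<close>-th entry.\<close>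

lemma sum_times_index_sum:
  "(\<Sum>I\<in>multi_indices d m. A I * index_sum d x I) =
   (\<Sum>k=1..d. \<Sum>i=1..m k. slice_sum d m A k i * x k i)"
proof -
  have "(\<Sum>I\<in>multi_indices d m. A I * x k (I k)) = (\<Sum>i=1..m k. slice_sum d m A k i * x k i)"
    if "k \<in> {1..d}" for k
  proof -
    have "(\<Sum>i=1..m k. \<Sum>I\<in>{I \<in> multi_indices d m. I k = i}. A I * x k (I k))
        = (\<Sum>I\<in>multi_indices d m. A I * x k (I k))"
      using multi_indices_in[OF _ that]
      by (intro sum.group finite_multi_indices) auto
    then show ?thesis
      by (simp add: slice_sum_def slice_indices_def sum_distrib_right)
  qed
  moreover have "(\<Sum>I\<in>multi_indices d m. A I * index_sum d x I) =
      (\<Sum>k=1..d. \<Sum>I\<in>multi_indices d m. A I * x k (I k))"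
    unfolding index_sum_def sum_distrib_left by (rule sum.swap)
  ultimately show ?thesis by simp
qed

lemma sum_times_index_sum_eq_margins:
  assumes "has_slice_sums d m A s"
  shows "(\<Sum>I\<in>multi_indices d m. A I * index_sum d x I) = (\<Sum>k=1..d. \<Sum>i=1..m k. s k i * x k i)"
  using assms by (simp add: sum_times_index_sum has_slice_sums_def)

section \<open>Necessity of the condition, and uniqueness\<close>

text \<open>A sum of nonpositive numbers is 0 only if all of them are.\<close>

lemma scaling_system_vanishes_iff:
  assumes "scaling_system d m B s x"
  shows "vanishes_on_support d m B x \<longleftrightarrow> zero_total_on_support d m B x"
  using assms finite_multi_indices[of d m]
    sum_nonneg_eq_0_iff[of "{I \<in> multi_indices d m. B I > 0}" "\<lambda>I. - index_sum d x I"]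
  unfolding scaling_system_def vanishes_on_support_def zero_total_on_support_def
  by (auto simp: sum_negf)

text \<open>Paired with \<open>A\<close>, a solution \<open>x\<close> of the system gives a sum of nonpositive terms with total 0.\<close>

lemma vanishes_if_scalable:
  assumes B: "B \<in> nonneg_tensors d m" and "pos_diag_equivalent d m A B" and A: "has_slice_sums d m A s"
    and x: "scaling_system d m B s x"
  shows "vanishes_on_support d m B x"
proof -
  obtain u where u: "\<And>I. I \<in> multi_indices d m \<Longrightarrow> A I = B I * exp (index_sum d u I)"
    using assms(2) by (auto simp: pos_diag_equivalent_def)
  have le: "A I * index_sum d x I \<le> 0" if I: "I \<in> multi_indices d m" for I
  proof -
    have "B I \<ge> 0" using B I by (auto simp: nonneg_tensors_def)
    then show ?thesis
      using x I u[OF I] by (cases "B I = 0") (auto simp: scaling_system_def mult_le_0_iff)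
  qed
  have "(\<Sum>I\<in>multi_indices d m. A I * index_sum d x I) = 0"
    using x by (simp add: sum_times_index_sum_eq_margins[OF A] scaling_system_def)
  then have "\<forall>I\<in>multi_indices d m. A I * index_sum d x I = 0"
    using sum_nonneg_eq_0_iff[OF finite_multi_indices, of d m "\<lambda>I. - (A I * index_sum d x I)"] le
    by (simp add: sum_negf)
  then show ?thesis
    using u by (force simp: vanishes_on_support_def)
qed

text \<open>Pairing \<open>A - A'\<close>, whose slice sums vanish, with the exponents \<open>z\<close> of the quotient of the two
  scalings gives a sum of terms \<open>A' I * (exp t - 1) * t \<ge> 0\<close>, with equality only if \<open>t = 0\<close> or
  \<open>A' I = 0\<close>. This is the strict convexity of the exponential in disguise.\<close>

lemma scaling_unique:
  assumes "A \<in> nonneg_tensors d m" "has_slice_sums d m A s" "pos_diag_equivalent d m A B"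
    and "A' \<in> nonneg_tensors d m" "has_slice_sums d m A' s" "pos_diag_equivalent d m A' B"
  shows "A = A'"
proof -
  obtain u u' where u: "\<And>I. I \<in> multi_indices d m \<Longrightarrow> A I = B I * exp (index_sum d u I)"
    and u': "\<And>I. I \<in> multi_indices d m \<Longrightarrow> A' I = B I * exp (index_sum d u' I)"
    using assms(3,6) by (auto simp: pos_diag_equivalent_def)
  define z where "z k i = u k i - u' k i" for k i
  have z: "index_sum d z I = index_sum d u I - index_sum d u' I" for I
    by (simp add: index_sum_def z_def sum_subtractf)
  have A: "A I = A' I * exp (index_sum d z I)" if "I \<in> multi_indices d m" for I
    using u[OF that] u'[OF that] by (simp add: z exp_diff)
  have nonneg: "(A I - A' I) * index_sum d z I \<ge> 0" if I: "I \<in> multi_indices d m" for I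
  proof -
    have "(exp t - 1) * t \<ge> 0" for t :: real
      by (cases "t \<ge> 0") (auto simp: zero_le_mult_iff)
    moreover have "A' I \<ge> 0" using assms(4) I by (auto simp: nonneg_tensors_def)
    ultimately have "A' I * ((exp (index_sum d z I) - 1) * index_sum d z I) \<ge> 0"
      by (rule mult_nonneg_nonneg[rotated])
    then show ?thesis by (simp add: A[OF I] algebra_simps)
  qed
  have "(\<Sum>I\<in>multi_indices d m. (A I - A' I) * index_sum d z I) = 0"
    using sum_times_index_sum_eq_margins[OF assms(2), of z] sum_times_index_sum_eq_margins[OF assms(5), of z]
    by (simp add: left_diff_distrib sum_subtractf)
  then have "\<forall>I\<in>multi_indices d m. (A I - A' I) * index_sum d z I = 0"
    using sum_nonneg_eq_0_iff[OF finite_multi_indices, of d m "\<lambda>I. (A I - A' I) * index_sum d z I"] nonneg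
    by blast
  then have "\<And>I. I \<in> multi_indices d m \<Longrightarrow> A I = A' I"
    using A by fastforce
  then show ?thesis
    using assms(1,4) unfolding nonneg_tensors_def by (intro PiE_ext) auto
qed

section \<open>Sufficiency of the condition\<close>

text \<open>The variables are indexed by the pairs \<open>(k, i)\<close>, and the coefficient \<open>s k i / \<sigma>\<close> subtracted in
  the linear forms \<open>a I\<close> plays two roles. It makes \<open>linear_form J (a I) y\<close> the index sum of the
  translate of \<open>y\<close> that satisfies the constraints \<open>s\<^sub>k\<^sup>T x\<^sub>k = 0\<close>, so that the minimisation is
  unconstrained. It also turns stationarity in the coordinate \<open>(k, i)\<close> into the statement that the
  \<open>(k, i)\<close> slice carries the fraction \<open>s k i / \<sigma>\<close> of the total mass, with no multipliers.\<close>

lemma scalable_if_vanishes: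
  fixes s :: "nat \<Rightarrow> nat \<Rightarrow> real"
  assumes "d \<ge> 1" and B: "B \<in> nonneg_tensors d m"
    and I\<^sub>0: "I\<^sub>0 \<in> multi_indices d m" "B I\<^sub>0 \<noteq> 0"
    and total: "\<And>k. k \<in> {1..d} \<Longrightarrow> (\<Sum>i=1..m k. s k i) = \<sigma>" and "\<sigma> > 0"
    and vanishes: "\<And>x. scaling_system d m B s x \<Longrightarrow> vanishes_on_support d m B x"
  shows "\<exists>A\<in>nonneg_tensors d m. pos_diag_equivalent d m A B \<and> has_slice_sums d m A s"
proof -
  define S where "S = {I \<in> multi_indices d m. B I > 0}"
  define J where "J = (SIGMA k:{1..d}. {1..m k})"
  define a where "a I = (\<lambda>(k, i). (if I k = i then 1 else 0) - s k i / \<sigma>)" for I :: "nat \<Rightarrow> nat"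
  define \<mu> where "\<mu> k y = (\<Sum>i=1..m k. s k i * y (k, i)) / \<sigma>" for k and y :: "nat \<times> nat \<Rightarrow> real"
  have fin: "finite S" "finite J"
    by (auto simp: S_def J_def finite_multi_indices)
  have form: "linear_form J (a I) y = index_sum d (\<lambda>k i. y (k, i)) I - (\<Sum>k=1..d. \<mu> k y)"
    if "I \<in> multi_indices d m" for I y
  proof -
    have "linear_form J (a I) y = (\<Sum>k=1..d. \<Sum>i=1..m k. a I (k, i) * y (k, i))"
      unfolding linear_form_def J_def by (subst sum.Sigma) auto
    also have "\<dots> = (\<Sum>k=1..d. y (k, I k) - \<mu> k y)"
    proof (rule sum.cong[OF refl])
      fix k assume "k \<in> {1..d}"
      have "(\<Sum>i=1..m k. a I (k, i) * y (k, i))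
          = (\<Sum>i=1..m k. (if I k = i then y (k, i) else 0)) - \<mu> k y"
        unfolding \<mu>_def sum_divide_distrib sum_subtractf[symmetric]
        by (intro sum.cong) (auto simp: a_def algebra_simps)
      then show "(\<Sum>i=1..m k. a I (k, i) * y (k, i)) = y (k, I k) - \<mu> k y"
        using multi_indices_in[OF that \<open>k \<in> {1..d}\<close>] by simp
    qed
    finally show ?thesis by (simp add: index_sum_def sum_subtractf)
  qed
  have "\<forall>I\<in>S. linear_form J (a I) y = 0" if le: "\<forall>I\<in>S. linear_form J (a I) y \<le> 0" for y
  proof -
    \<comment> \<open>The translate of \<open>y\<close> with \<open>s\<close>-weighted mean 0 in each mode.\<close>
    define x where "x k i = y (k, i) - \<mu> k y" for k i
    have x: "index_sum d x I = linear_form J (a I) y" if "I \<in> multi_indices d m" for I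
      by (simp add: form[OF that]) (simp add: index_sum_def x_def sum_subtractf)
    have "(\<Sum>i=1..m k. s k i * x k i) = 0" if "k \<in> {1..d}" for k
    proof -
      have "(\<Sum>i=1..m k. s k i * x k i) = (\<Sum>i=1..m k. s k i * y (k, i)) - \<sigma> * \<mu> k y"
        unfolding x_def right_diff_distrib sum_subtractf sum_distrib_right[symmetric] total[OF that] ..
      then show ?thesis using \<open>\<sigma> > 0\<close> by (simp add: \<mu>_def)
    qed
    then have "scaling_system d m B s x"
      using le x by (auto simp: scaling_system_def S_def)
    from vanishes[OF this] show ?thesis
      using x by (auto simp: vanishes_on_support_def S_def)
  qed
  then obtain y where min: "\<And>z. exp_sum S J B a y \<le> exp_sum S J B a z"
    using exp_sum_attains_min[OF fin, of B a] by (auto simp: S_def)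
  define A\<^sub>0 where "A\<^sub>0 I = B I * exp (linear_form J (a I) y)" for I
  define T where "T = (\<Sum>I\<in>multi_indices d m. A\<^sub>0 I)"
  have B_nonneg: "B I \<ge> 0" if "I \<in> multi_indices d m" for I
    using that B by (auto simp: nonneg_tensors_def)
  have B_zero: "B I = 0" if "I \<in> multi_indices d m - S" for I
    using that B_nonneg[of I] by (auto simp: S_def)
  have "T > 0"
  proof -
    have "B I\<^sub>0 > 0"
      using I\<^sub>0 B_nonneg by (simp add: order_less_le)
    then show ?thesis
      unfolding T_def A\<^sub>0_def using I\<^sub>0(1) B_nonneg
      by (intro sum_pos2[of _ I\<^sub>0] finite_multi_indices) auto
  qed
  have slice: "slice_sum d m A\<^sub>0 k i = s k i / \<sigma> * T" if ki: "k \<in> {1..d}" "i \<in> {1..m k}" for k i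
  proof -
    have "0 = (\<Sum>I\<in>S. A\<^sub>0 I * a I (k, i))"
      using exp_sum_stationary[OF fin(2) _ min, of "(k, i)"] ki by (simp add: J_def A\<^sub>0_def)
    also have "\<dots> = (\<Sum>I\<in>multi_indices d m. A\<^sub>0 I * a I (k, i))"
      using B_zero by (intro sum.mono_neutral_left finite_multi_indices) (auto simp: S_def A\<^sub>0_def)
    also have "\<dots> = (\<Sum>I\<in>multi_indices d m. if I k = i then A\<^sub>0 I else 0) - T * (s k i / \<sigma>)"
      unfolding T_def sum_distrib_right sum_subtractf[symmetric]
      by (intro sum.cong) (auto simp: a_def algebra_simps)
    also have "(\<Sum>I\<in>multi_indices d m. if I k = i then A\<^sub>0 I else 0) = slice_sum d m A\<^sub>0 k i"
      by (simp add: slice_sum_def slice_indices_def sum.inter_filter finite_multi_indices)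
    finally show ?thesis by simp
  qed
  \<comment> \<open>Rescaling the total mass from \<open>T\<close> to \<open>\<sigma>\<close> corrects all slice sums at once. The scalar
    \<open>\<sigma> / T\<close> and the correction in the exponent do not depend on \<open>I\<close>, so adding \<open>C\<close> to all entries of
    the first vector accounts for both.\<close>
  define A where "A = (\<lambda>I\<in>multi_indices d m. \<sigma> / T * A\<^sub>0 I)"
  define C where "C = ln (\<sigma> / T) - (\<Sum>k=1..d. \<mu> k y)"
  define x where "x k i = y (k, i) + (if k = 1 then C else 0)" for k i
  have "A I = B I * exp (index_sum d x I)" if "I \<in> multi_indices d m" for I
  proof -
    have "index_sum d x I = linear_form J (a I) y + ln (\<sigma> / T)"
      using \<open>d \<ge> 1\<close> by (simp add: form[OF that] index_sum_def x_def C_def sum.distrib)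
    then show ?thesis
      using that \<open>\<sigma> > 0\<close> \<open>T > 0\<close> by (simp add: A_def A\<^sub>0_def exp_add)
  qed
  then have "pos_diag_equivalent d m A B"
    by (auto simp: pos_diag_equivalent_def)
  moreover have "A \<in> nonneg_tensors d m"
    using B_nonneg \<open>\<sigma> > 0\<close> \<open>T > 0\<close> by (auto simp: A_def A\<^sub>0_def nonneg_tensors_def)
  moreover have "has_slice_sums d m A s"
    unfolding has_slice_sums_def
  proof (intro ballI)
    fix k i assume ki: "k \<in> {1..d}" "i \<in> {1..m k}"
    have "slice_sum d m A k i = \<sigma> / T * slice_sum d m A\<^sub>0 k i"
      by (simp add: slice_sum_def slice_indices_def A_def sum_distrib_left)
    then show "slice_sum d m A k i = s k i"
      using slice[OF ki] \<open>\<sigma> > 0\<close> \<open>T > 0\<close> by simp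
  qed
  ultimately show ?thesis by blast
qed

theorem theorem1p1:
  fixes d :: nat and m :: "nat \<Rightarrow> nat"
    and B :: "(nat \<Rightarrow> nat) \<Rightarrow> real" and s :: "nat \<Rightarrow> nat \<Rightarrow> real"
  assumes "d \<ge> 2"
    and "\<forall>k\<in>{1..d}. m k > 0"
    and "B \<in> nonneg_tensors d m"
    and "\<forall>k\<in>{1..d}. \<forall>i\<in>{1..m k}. \<not> zero_slice d m B k i"
    and "\<forall>k\<in>{1..d}. \<forall>i\<in>{1..m k}. s k i > 0"
    and "\<forall>k\<in>{1..d}. \<forall>l\<in>{1..d}. (\<Sum>i=1..m k. s k i) = (\<Sum>i=1..m l. s l i)"
  shows "(\<forall>x. scaling_system d m B s x \<longrightarrow>
            (vanishes_on_support d m B x \<longleftrightarrow> zero_total_on_support d m B x)) \<and>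
         ((\<exists>A\<in>nonneg_tensors d m. pos_diag_equivalent d m A B \<and> has_slice_sums d m A s) \<longleftrightarrow>
            (\<forall>x. scaling_system d m B s x \<longrightarrow>
              vanishes_on_support d m B x \<or> zero_total_on_support d m B x)) \<and>
         (\<exists>\<^sub>\<le>\<^sub>1 A. A \<in> nonneg_tensors d m \<and> has_slice_sums d m A s \<and> pos_diag_equivalent d m A B)"
proof (intro conjI)
  show "\<forall>x. scaling_system d m B s x \<longrightarrow>
      (vanishes_on_support d m B x \<longleftrightarrow> zero_total_on_support d m B x)"
    using scaling_system_vanishes_iff by blast
  show "(\<exists>A\<in>nonneg_tensors d m. pos_diag_equivalent d m A B \<and> has_slice_sums d m A s) \<longleftrightarrow>
      (\<forall>x. scaling_system d m B s x \<longrightarrow>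
        vanishes_on_support d m B x \<or> zero_total_on_support d m B x)"
  proof
    assume "\<exists>A\<in>nonneg_tensors d m. pos_diag_equivalent d m A B \<and> has_slice_sums d m A s"
    then show "\<forall>x. scaling_system d m B s x \<longrightarrow>
        vanishes_on_support d m B x \<or> zero_total_on_support d m B x"
      using vanishes_if_scalable[OF assms(3)] by blast
  next
    assume *: "\<forall>x. scaling_system d m B s x \<longrightarrow>
        vanishes_on_support d m B x \<or> zero_total_on_support d m B x"
    have one: "1 \<in> {1..d}" "1 \<in> {1..m 1}"
      using assms(1,2) by (auto simp: Suc_le_eq)
    then obtain I\<^sub>0 where "I\<^sub>0 \<in> multi_indices d m" "B I\<^sub>0 \<noteq> 0"
      using assms(4) unfolding zero_slice_def slice_indices_def by blast
    then show "\<exists>A\<in>nonneg_tensors d m. pos_diag_equivalent d m A B \<and> has_slice_sums d m A s"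
    proof (rule scalable_if_vanishes[rotated 2])
      show "(\<Sum>i=1..m k. s k i) = (\<Sum>i=1..m 1. s 1 i)" if "k \<in> {1..d}" for k
        using assms(6) that one(1) by blast
      show "(\<Sum>i=1..m 1. s 1 i) > 0"
        using assms(5) one by (intro sum_pos) auto
      show "vanishes_on_support d m B x" if "scaling_system d m B s x" for x
        using * that scaling_system_vanishes_iff by blast
    qed (use assms one in auto)
  qed
  show "\<exists>\<^sub>\<le>\<^sub>1 A. A \<in> nonneg_tensors d m \<and> has_slice_sums d m A s \<and> pos_diag_equivalent d m A B"
    unfolding Uniq_def using scaling_unique by blast
qed

end
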